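(* Let $d\ge 1$ and let $\psi\in\mathbb{R}[x]=\mathbb{R}[x_1,\dots,x_d]$ be a polynomial which has at least three non-constant polynomial factors, i.e. $\psi=\varphi_1\varphi_2\cdots\varphi_k$ with $k\ge 3$ and each $\varphi_j\in\mathbb{R}[x]$ non-constant, and suppose that two of the factors have a common zero, i.e. there exist $i\neq j$ and $x_0\in\mathbb{R}^d$ with $\varphi_i(x_0)=\varphi_j(x_0)=0$. Then the Fischer operator $F_\psi:\mathbb{R}[x]\to\mathbb{R}[x]$, $F_\psi(q)=\Delta(\psi q)$, is not surjective.
   Context: $\mathbb{R}[x]$ denotes the set of all polynomials in $d$ variables with real coefficients, and $\Delta=\frac{\partial^2}{\partial x_1^2}+\cdots+\frac{\partial^2}{\partial x_d^2}$ is the Laplacian. For $\psi\in\mathbb{R}[x]$ the Fischer operator is $F_\psi(q):=\Delta(\psi q)$ for $q\in\mathbb{R}[x]$. *)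

theory Defs
  imports Complex_Main "HOL-Library.Poly_Mapping"
begin

text \<open>Multivariate real polynomials in variables x_0, x_1, ...: finitely supported maps
  from monomials (finitely supported exponent vectors) to real coefficients.
  Multiplication is the library's convolution, so this is the polynomial ring.\<close>
type_synonym mpoly = "(nat \<Rightarrow>\<^sub>0 nat) \<Rightarrow>\<^sub>0 real"

text \<open>p lies in R[x_0,...,x_(d-1)] (the paper's variables x_1..x_d).\<close>
definition in_vars :: "nat \<Rightarrow> mpoly \<Rightarrow> bool" where
  "in_vars d p \<longleftrightarrow> (\<forall>m\<in>Poly_Mapping.keys p. Poly_Mapping.keys m \<subseteq> {..<d})"

definition nonconstant :: "mpoly \<Rightarrow> bool" where
  "nonconstant p \<longleftrightarrow> (\<exists>m\<in>Poly_Mapping.keys p. m \<noteq> 0)"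

definition pd :: "nat \<Rightarrow> mpoly \<Rightarrow> mpoly" where
  "pd i p = (\<Sum>m\<in>Poly_Mapping.keys p. Poly_Mapping.single (m - Poly_Mapping.single i 1)
                (of_nat (Poly_Mapping.lookup m i) * Poly_Mapping.lookup p m))"

definition laplacian :: "nat \<Rightarrow> mpoly \<Rightarrow> mpoly" where
  "laplacian d p = (\<Sum>i<d. pd i (pd i p))"

definition fischer :: "nat \<Rightarrow> mpoly \<Rightarrow> mpoly \<Rightarrow> mpoly" where
  "fischer d \<psi> q = laplacian d (\<psi> * q)"

definition meval :: "mpoly \<Rightarrow> (nat \<Rightarrow> real) \<Rightarrow> real" where
  "meval p x = (\<Sum>m\<in>Poly_Mapping.keys p. Poly_Mapping.lookup p m * (\<Prod>i\<in>Poly_Mapping.keys m. x i ^ Poly_Mapping.lookup m i))"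

end

theory Submission
  imports Defs
begin

text \<open>Let \<open>\<theta>\<close> be the product of the two factors with the common zero \<open>x0\<close> and \<open>\<chi>\<close> the product of
  the others, and write \<open>F\<close> for the Fischer operators. Since \<open>\<theta>\<close> vanishes to order two at \<open>x0\<close>,
  for each \<open>n\<close> the operator \<open>F\<^sub>\<theta>\<close> preserves the space of polynomials vanishing to order \<open>n\<close> at \<open>x0\<close>,
  which has finite codimension. If \<open>F\<^sub>\<psi>\<close> is surjective, so is \<open>F\<^sub>\<theta>\<close>, because
  \<open>F\<^sub>\<psi> q = F\<^sub>\<theta> (\<chi> q)\<close>; hence \<open>F\<^sub>\<theta>\<close> is bijective on each of these finite-dimensional quotients,
  and therefore injective. Solving \<open>F\<^sub>\<psi> q = F\<^sub>\<theta> 1\<close> then gives \<open>\<chi> q = 1\<close>, although \<open>\<chi>\<close> is a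
  nonempty product of nonconstant polynomials.\<close>

section \<open>Derivatives and evaluation of polynomials\<close>

lemma mpoly_induct [case_names zero single add]:
  fixes p :: mpoly
  assumes "P 0" "\<And>m c. P (Poly_Mapping.single m c)" "\<And>p q. P p \<Longrightarrow> P q \<Longrightarrow> P (p + q)"
  shows "P p"
proof -
  have "p = (\<Sum>m\<in>Poly_Mapping.keys p. Poly_Mapping.single m (Poly_Mapping.lookup p m))"
    by (rule poly_mapping_eqI)
      (auto simp: lookup_sum lookup_single when_def sum.delta' in_keys_iff)
  moreover have "P (\<Sum>m\<in>S. Poly_Mapping.single m (Poly_Mapping.lookup p m))" if "finite S" for S
    using that by (induction S rule: finite_induct) (auto intro: assms)
  ultimately show ?thesis
    by (metis finite_keys)
qed

text \<open>Exponent subtraction truncates at 0, so \<open>n - ?e\<close> could identify different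
  monomials; the factor \<open>lookup n i\<close> kills exactly the terms where truncation
  occurs.\<close>

lemma lookup_pd:
  "Poly_Mapping.lookup (pd i p) m =
     of_nat (Suc (Poly_Mapping.lookup m i)) * Poly_Mapping.lookup p (m + Poly_Mapping.single i 1)"
proof -
  let ?e = "Poly_Mapping.single i 1 :: nat \<Rightarrow>\<^sub>0 nat"
  have shift: "n - ?e = m \<longleftrightarrow> n = m + ?e" if "Poly_Mapping.lookup n i \<noteq> 0" for n
  proof -
    have "n - ?e + ?e = n"
      using that by (intro poly_mapping_eqI) (auto simp: lookup_add lookup_minus lookup_single when_def)
    then show ?thesis
      by (metis add_diff_cancel_right')
  qed
  have "Poly_Mapping.lookup (pd i p) m = (\<Sum>n\<in>Poly_Mapping.keys p.
      (of_nat (Poly_Mapping.lookup n i) * Poly_Mapping.lookup p n when n - ?e = m))"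
    by (simp add: pd_def lookup_sum lookup_single)
  also have "\<dots> = (\<Sum>n\<in>Poly_Mapping.keys p.
      if n = m + ?e then of_nat (Poly_Mapping.lookup n i) * Poly_Mapping.lookup p n else 0)"
    by (rule sum.cong[OF refl]) (use shift in \<open>fastforce simp: when_def lookup_add\<close>)
  also have "\<dots> = of_nat (Poly_Mapping.lookup (m + ?e) i) * Poly_Mapping.lookup p (m + ?e)"
    by (auto simp: sum.delta in_keys_iff)
  finally show ?thesis
    by (simp add: lookup_add)
qed

lemma pd_0 [simp]: "pd i 0 = 0"
  by (simp add: pd_def)

lemma pd_add: "pd i (p + q) = pd i p + pd i q"
  by (rule poly_mapping_eqI) (simp add: lookup_pd lookup_add algebra_simps)

lemma pd_single:
  "pd i (Poly_Mapping.single m c) =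
     Poly_Mapping.single (m - Poly_Mapping.single i 1) (of_nat (Poly_Mapping.lookup m i) * c)"
  by (cases "c = 0") (auto simp: pd_def)

lemma pd_mult: "pd i (p * q) = pd i p * q + p * pd i q"
proof (induction p rule: mpoly_induct)
  case (single m a)
  show ?case
  proof (induction q rule: mpoly_induct)
    case (single n b)
    let ?e = "Poly_Mapping.single i 1 :: nat \<Rightarrow>\<^sub>0 nat"
    have shift: "k - ?e + l = k + l - ?e" if "Poly_Mapping.lookup k i \<noteq> 0" for k l
      using that by (intro poly_mapping_eqI) (auto simp: lookup_add lookup_minus lookup_single when_def)
    \<comment> \<open>If the exponent of \<open>i\<close> in \<open>k\<close> is 0, the subtraction
      truncates and the monomials may differ, but then both coefficients are 0.\<close>
    have term1: "Poly_Mapping.single (k - ?e + l) (of_nat (Poly_Mapping.lookup k i) * c)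
        = Poly_Mapping.single (k + l - ?e) (of_nat (Poly_Mapping.lookup k i) * c)" for k l and c :: real
      using shift[of k l] by (cases "Poly_Mapping.lookup k i = 0") auto
    show ?case
      using term1[of m n "a * b"] term1[of n m "a * b"]
      by (simp add: pd_single mult_single lookup_add algebra_simps flip: single_add)
  qed (simp_all add: pd_add algebra_simps)
qed (simp_all add: pd_add algebra_simps)

lemma meval_superset:
  assumes "finite S" "Poly_Mapping.keys p \<subseteq> S"
  shows "meval p x = (\<Sum>m\<in>S. Poly_Mapping.lookup p m *
    (\<Prod>i\<in>Poly_Mapping.keys m. x i ^ Poly_Mapping.lookup m i))"
  unfolding meval_def
  by (rule sum.mono_neutral_left) (use assms in \<open>auto simp: in_keys_iff\<close>)

lemma meval_0 [simp]: "meval 0 x = 0"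
  by (simp add: meval_def)

lemma meval_add: "meval (p + q) x = meval p x + meval q x"
proof -
  let ?S = "Poly_Mapping.keys p \<union> Poly_Mapping.keys q"
  show ?thesis
    using keys_add[of p q]
    by (simp add: meval_superset[of ?S] lookup_add sum.distrib[symmetric] algebra_simps)
qed

lemma meval_single:
  "meval (Poly_Mapping.single m c) x =
     c * (\<Prod>i\<in>Poly_Mapping.keys m. x i ^ Poly_Mapping.lookup m i)"
  by (cases "c = 0") (auto simp: meval_def)

lemma meval_mult: "meval (p * q) x = meval p x * meval q x"
proof (induction p rule: mpoly_induct)
  case (single m a)
  show ?case
  proof (induction q rule: mpoly_induct)
    case (single n b)
    let ?S = "Poly_Mapping.keys m \<union> Poly_Mapping.keys n"
    have superset: "(\<Prod>i\<in>Poly_Mapping.keys k. x i ^ Poly_Mapping.lookup k i)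
        = (\<Prod>i\<in>?S. x i ^ Poly_Mapping.lookup k i)" if "Poly_Mapping.keys k \<subseteq> ?S" for k
      by (rule prod.mono_neutral_left) (use that in \<open>auto simp: in_keys_iff\<close>)
    show ?case
      using superset[of m] superset[of n] superset[OF keys_add]
      by (simp add: mult_single meval_single lookup_add power_add prod.distrib)
  qed (simp_all add: meval_add algebra_simps)
qed (simp_all add: meval_add algebra_simps)

section \<open>Linearity of the Laplacian and of Fischer operators\<close>

lemma laplacian_0 [simp]: "laplacian d 0 = 0"
  by (simp add: laplacian_def)

lemma laplacian_add: "laplacian d (p + q) = laplacian d p + laplacian d q"
  by (simp add: laplacian_def pd_add sum.distrib)

lemma laplacian_scale:
  "laplacian d (Poly_Mapping.single 0 c * p) = Poly_Mapping.single 0 c * laplacian d p"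
  by (simp add: laplacian_def pd_mult pd_single sum_distrib_left)

lemma fischer_0 [simp]: "fischer d \<theta> 0 = 0"
  by (simp add: fischer_def)

lemma fischer_add: "fischer d \<theta> (p + q) = fischer d \<theta> p + fischer d \<theta> q"
  by (simp add: fischer_def laplacian_add distrib_left)

lemma fischer_minus: "fischer d \<theta> (p - q) = fischer d \<theta> p - fischer d \<theta> q"
  using fischer_add[of d \<theta> "p - q" q] by simp

lemma fischer_scale:
  "fischer d \<theta> (Poly_Mapping.single 0 c * p) = Poly_Mapping.single 0 c * fischer d \<theta> p"
  by (simp add: fischer_def mult.left_commute[of \<theta>] laplacian_scale)

lemma fischer_sum: "fischer d \<theta> (sum f S) = (\<Sum>s\<in>S. fischer d \<theta> (f s))"
  by (induction S rule: infinite_finite_induct) (simp_all add: fischer_add)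

section \<open>Closure properties of the ring in \<open>d\<close> variables\<close>

lemma in_vars_1: "in_vars d 1"
  by (simp add: in_vars_def)

lemma in_vars_mult:
  assumes "in_vars d p" "in_vars d q"
  shows "in_vars d (p * q)"
  unfolding in_vars_def
proof
  fix m assume "m \<in> Poly_Mapping.keys (p * q)"
  then obtain a b where "m = a + b" "a \<in> Poly_Mapping.keys p" "b \<in> Poly_Mapping.keys q"
    using keys_mult[of p q] by blast
  then show "Poly_Mapping.keys m \<subseteq> {..<d}"
    using assms keys_add[of a b] unfolding in_vars_def by blast
qed

lemma in_vars_diff:
  fixes p q :: mpoly
  assumes "in_vars d p" "in_vars d q"
  shows "in_vars d (p - q)"
proof -
  have "Poly_Mapping.keys (p - q) \<subseteq> Poly_Mapping.keys p \<union> Poly_Mapping.keys q"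
    by (auto simp: in_keys_iff lookup_minus)
  then show ?thesis
    using assms unfolding in_vars_def by blast
qed

lemma in_vars_prod: "(\<And>s. s \<in> S \<Longrightarrow> in_vars d (f s)) \<Longrightarrow> in_vars d (prod f S)"
  by (induction S rule: infinite_finite_induct) (simp_all add: in_vars_1 in_vars_mult)

lemma in_vars_pd:
  assumes "in_vars d p"
  shows "in_vars d (pd i p)"
  unfolding in_vars_def
proof
  fix m assume "m \<in> Poly_Mapping.keys (pd i p)"
  then have "m + Poly_Mapping.single i 1 \<in> Poly_Mapping.keys p"
    by (auto simp: in_keys_iff lookup_pd)
  then have "Poly_Mapping.keys (m + Poly_Mapping.single i 1) \<subseteq> {..<d}"
    using assms by (auto simp: in_vars_def)
  moreover have "Poly_Mapping.keys m \<subseteq> Poly_Mapping.keys (m + Poly_Mapping.single i 1)"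
    by (auto simp: in_keys_iff lookup_add)
  ultimately show "Poly_Mapping.keys m \<subseteq> {..<d}"
    by blast
qed

lemma in_vars_laplacian:
  assumes "in_vars d p"
  shows "in_vars d (laplacian d p)"
proof -
  have "in_vars d (\<Sum>s\<in>S. f s)" if "\<And>s. s \<in> S \<Longrightarrow> in_vars d (f s)" for S and f :: "nat \<Rightarrow> mpoly"
    using that keys_sum[of f S] unfolding in_vars_def by blast
  then show ?thesis
    by (simp add: laplacian_def in_vars_pd assms)
qed

section \<open>Units of the polynomial ring\<close>

text \<open>The order on monomials is lexicographic: at the first differing index, a natural number
  would have to be below 0.\<close>

lemma zero_le_monomial: "0 \<le> (m :: nat \<Rightarrow>\<^sub>0 nat)"
proof -
  have "\<not> m < 0"
    by transfer (auto simp: less_fun_def)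
  then show ?thesis
    by simp
qed

text \<open>The largest monomials \<open>M\<close> and \<open>N\<close> multiply without
  cancellation, so \<open>M + N\<close> occurs in \<open>p * q\<close>. As 1 has only the monomial
  0, \<open>M = 0\<close> bounds all monomials of \<open>p\<close>.\<close>

lemma unit_not_nonconstant:
  assumes unit: "p * q = (1 :: mpoly)"
  shows "\<not> nonconstant p"
proof -
  let ?K = Poly_Mapping.keys and ?L = Poly_Mapping.lookup
  have "?K p \<noteq> {}" "?K q \<noteq> {}"
    using unit by auto
  define M where "M = Max (?K p)"
  define N where "N = Max (?K q)"
  have M: "M \<in> ?K p" "\<And>m. m \<in> ?K p \<Longrightarrow> m \<le> M" and N: "N \<in> ?K q" "\<And>m. m \<in> ?K q \<Longrightarrow> m \<le> N"
    using \<open>?K p \<noteq> {}\<close> \<open>?K q \<noteq> {}\<close> by (auto simp: M_def N_def)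
  define p' where "p' = p - Poly_Mapping.single M (?L p M)"
  define q' where "q' = q - Poly_Mapping.single N (?L q N)"
  have p': "m < M" if "m \<in> ?K p'" for m
  proof -
    have "m \<noteq> M" "m \<in> ?K p"
      using that by (auto simp: p'_def in_keys_iff lookup_minus lookup_single when_def split: if_splits)
    then show ?thesis
      using M(2) by (auto simp: less_le)
  qed
  have q': "m < N" if "m \<in> ?K q'" for m
  proof -
    have "m \<noteq> N" "m \<in> ?K q"
      using that by (auto simp: q'_def in_keys_iff lookup_minus lookup_single when_def split: if_splits)
    then show ?thesis
      using N(2) by (auto simp: less_le)
  qed
  \<comment> \<open>The monomial order is linear and compatible with addition, so a product
    involving a non-leading term stays strictly below \<open>M + N\<close>.\<close>
  have "M + N \<notin> ?K (p' * q)"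
  proof
    assume "M + N \<in> ?K (p' * q)"
    then obtain a b where "M + N = a + b" "a \<in> ?K p'" "b \<in> ?K q"
      using keys_mult[of p' q] by blast
    with p' N(2) show False
      by (metis add_less_le_mono less_irrefl)
  qed
  moreover have "M + N \<notin> ?K (Poly_Mapping.single M (?L p M) * q')"
  proof
    assume "M + N \<in> ?K (Poly_Mapping.single M (?L p M) * q')"
    then obtain a b where "M + N = a + b" "a \<in> ?K (Poly_Mapping.single M (?L p M))" "b \<in> ?K q'"
      using keys_mult[of "Poly_Mapping.single M (?L p M)" q'] by blast
    with q' show False
      by (auto split: if_splits)
  qed
  moreover have "p * q = p' * q + Poly_Mapping.single M (?L p M) * q'
      + Poly_Mapping.single (M + N) (?L p M * ?L q N)"
    by (simp add: p'_def q'_def algebra_simps flip: mult_single)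
  ultimately have "?L (p * q) (M + N) = ?L p M * ?L q N"
    by (simp add: lookup_add in_keys_iff)
  also have "\<dots> \<noteq> 0"
    using M(1) N(1) by (simp add: in_keys_iff)
  finally have "M + N = 0"
    using unit by (auto simp: lookup_one when_def split: if_splits)
  then have "M = 0"
    by (metis add_is_0 lookup_add lookup_zero poly_mapping_eqI)
  then show ?thesis
    using M(2) zero_le_monomial unfolding nonconstant_def by (metis order_antisym)
qed

section \<open>Order of vanishing at a point\<close>

text \<open>Words of indices stand for iterated derivatives. Compared with multi-indices they allow
  recursion on the first letter, without commuting derivatives.\<close>

definition vanishes :: "nat \<Rightarrow> (nat \<Rightarrow> real) \<Rightarrow> nat \<Rightarrow> mpoly \<Rightarrow> bool" where
  "vanishes d x n p \<longleftrightarrow> (\<forall>w. set w \<subseteq> {..<d} \<longrightarrow> length w < n \<longrightarrow> meval (fold pd w p) x = 0)"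

lemma vanishes_0 [simp]: "vanishes d x 0 p"
  by (simp add: vanishes_def)

lemma vanishes_Suc:
  "vanishes d x (Suc n) p \<longleftrightarrow> meval p x = 0 \<and> (\<forall>i<d. vanishes d x n (pd i p))" (is "?L \<longleftrightarrow> ?R")
proof
  assume L: ?L
  have "meval p x = 0"
    using L unfolding vanishes_def by (auto dest!: spec[of _ "[]"])
  moreover have "vanishes d x n (pd i p)" if "i < d" for i
    unfolding vanishes_def
  proof (intro allI impI)
    fix w :: "nat list" assume "set w \<subseteq> {..<d}" "length w < n"
    then show "meval (fold pd w (pd i p)) x = 0"
      using L that unfolding vanishes_def by (auto dest!: spec[of _ "i # w"])
  qed
  ultimately show ?R
    by blast
next
  assume R: ?R
  show ?L
    unfolding vanishes_def
  proof (intro allI impI)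
    fix w :: "nat list" assume "set w \<subseteq> {..<d}" "length w < Suc n"
    then show "meval (fold pd w p) x = 0"
      using R by (cases w) (auto simp: vanishes_def)
  qed
qed

lemma vanishes_SucD: "vanishes d x (Suc n) p \<Longrightarrow> vanishes d x n p"
  by (auto simp: vanishes_def)

lemma vanishes_add: "vanishes d x n p \<Longrightarrow> vanishes d x n q \<Longrightarrow> vanishes d x n (p + q)"
  by (induction n arbitrary: p q) (auto simp: vanishes_Suc pd_add meval_add)

lemma vanishes_zero [simp]: "vanishes d x n 0"
  by (induction n) (auto simp: vanishes_Suc)

lemma vanishes_sum: "(\<And>s. s \<in> S \<Longrightarrow> vanishes d x n (f s)) \<Longrightarrow> vanishes d x n (sum f S)"
  by (induction S rule: infinite_finite_induct) (simp_all add: vanishes_add)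

lemma vanishes_mult: "vanishes d x n p \<Longrightarrow> vanishes d x n (g * p)"
proof (induction n arbitrary: p g)
  case (Suc n)
  then have "vanishes d x n p"
    using vanishes_SucD by blast
  with Suc show ?case
    by (auto simp: vanishes_Suc pd_mult meval_mult intro!: vanishes_add)
qed simp

text \<open>In the product rule, \<open>pd i g * p\<close> keeps the full order of \<open>p\<close>,
  and in \<open>g * pd i p\<close> the root of \<open>g\<close> makes up for the order lost by
  differentiating \<open>p\<close>.\<close>

lemma vanishes_mult_root:
  assumes "meval g x = 0"
  shows "vanishes d x n p \<Longrightarrow> vanishes d x (Suc n) (g * p)"
proof (induction n arbitrary: p)
  case 0
  then show ?case
    using assms by (simp add: vanishes_Suc meval_mult)
next
  case (Suc n)
  have "vanishes d x (Suc n) (pd i (g * p))" if "i < d" for i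
  proof -
    have "vanishes d x (Suc n) (pd i g * p)"
      using Suc.prems by (rule vanishes_mult)
    moreover have "vanishes d x (Suc n) (g * pd i p)"
      using Suc that by (simp add: vanishes_Suc)
    ultimately show ?thesis
      by (simp add: pd_mult vanishes_add)
  qed
  then show ?case
    using assms by (subst vanishes_Suc) (simp add: meval_mult)
qed

lemma vanishes_laplacian: "vanishes d x (Suc (Suc n)) p \<Longrightarrow> vanishes d x n (laplacian d p)"
  unfolding laplacian_def by (rule vanishes_sum) (simp add: vanishes_Suc)

text \<open>The common zero enters here: the two roots gain two orders of vanishing, which the
  second-order operator then loses.\<close>

lemma vanishes_fischer:
  assumes "meval g x = 0" "meval h x = 0" "vanishes d x n p"
  shows "vanishes d x n (fischer d (g * h) p)"
  unfolding fischer_def mult.assoc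
  by (intro vanishes_laplacian vanishes_mult_root assms)

section \<open>Iterated derivatives determine a polynomial\<close>

lemma fold_pd_0 [simp]: "fold pd w 0 = 0"
  by (induction w) simp_all

lemma fold_pd_add: "fold pd w (p + q) = fold pd w p + fold pd w q"
  by (induction w arbitrary: p q) (simp_all add: pd_add)

lemma fold_pd_scale: "fold pd w (Poly_Mapping.single 0 c * p) = Poly_Mapping.single 0 c * fold pd w p"
  by (induction w arbitrary: p) (simp_all add: pd_mult pd_single)

lemma meval_fold_pd_lincomb:
  "meval (fold pd w (\<Sum>j\<in>J. Poly_Mapping.single 0 (c j) * v j)) x =
     (\<Sum>j\<in>J. c j * meval (fold pd w (v j)) x)"
  by (induction J rule: infinite_finite_induct)
    (simp_all add: fold_pd_add fold_pd_scale meval_add meval_mult meval_single)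

text \<open>Induction on the degree bound: all first derivatives have smaller degree and are 0, so
  \<open>p\<close> is constant, with value 0 at \<open>x\<close>.\<close>

lemma eq_0_if_vanishes_degree:
  assumes "in_vars d p" "vanishes d x (Suc n) p"
    and "\<And>m. m \<in> Poly_Mapping.keys p \<Longrightarrow> (\<Sum>i<d. Poly_Mapping.lookup m i) \<le> n"
  shows "p = 0"
  using assms
proof (induction n arbitrary: p)
  case 0
  have "m = 0" if "m \<in> Poly_Mapping.keys p" for m
  proof (rule poly_mapping_eqI)
    fix i
    show "Poly_Mapping.lookup m i = Poly_Mapping.lookup 0 i"
    proof (cases "i < d")
      case True
      with "0.prems"(3)[OF that] show ?thesis
        by simp
    next
      case False
      with "0.prems"(1) that have "i \<notin> Poly_Mapping.keys m"
        by (auto simp: in_vars_def)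
      then show ?thesis
        by (simp add: in_keys_iff)
    qed
  qed
  then have "Poly_Mapping.keys p \<subseteq> {0}"
    by blast
  then have "meval p x = Poly_Mapping.lookup p 0"
    by (simp add: meval_superset[of "{0}"])
  with "0.prems"(2) have "Poly_Mapping.lookup p 0 = 0"
    by (simp add: vanishes_Suc)
  with \<open>Poly_Mapping.keys p \<subseteq> {0}\<close> show ?case
    by (metis in_keys_iff keys_eq_empty subset_singletonD singletonI)
next
  case (Suc n)
  have pd0: "pd i p = 0" if "i < d" for i
  proof (rule Suc.IH)
    show "in_vars d (pd i p)"
      using Suc.prems(1) by (rule in_vars_pd)
    show "vanishes d x (Suc n) (pd i p)"
      using Suc.prems(2) that by (simp add: vanishes_Suc[of d x "Suc n"])
    fix m assume "m \<in> Poly_Mapping.keys (pd i p)"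
    then have "m + Poly_Mapping.single i 1 \<in> Poly_Mapping.keys p"
      by (auto simp: in_keys_iff lookup_pd)
    from Suc.prems(3)[OF this] that show "(\<Sum>j<d. Poly_Mapping.lookup m j) \<le> n"
      by (simp add: lookup_add lookup_single sum.distrib when_def)
  qed
  have const: "m = 0" if m: "m \<in> Poly_Mapping.keys p" for m
  proof (rule ccontr)
    assume "m \<noteq> 0"
    then obtain i where i: "i \<in> Poly_Mapping.keys m"
      by (metis in_keys_iff lookup_zero poly_mapping_eqI)
    have "i < d"
      using Suc.prems(1) m i by (auto simp: in_vars_def)
    have "m - Poly_Mapping.single i 1 + Poly_Mapping.single i 1 = m"
      using i by (intro poly_mapping_eqI)
        (auto simp: lookup_add lookup_minus lookup_single when_def in_keys_iff)
    \<comment> \<open>The term at \<open>m\<close> survives differentiation in \<open>i\<close>,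
      since its exponent there is positive.\<close>
    then have "Poly_Mapping.lookup (pd i p) (m - Poly_Mapping.single i 1) \<noteq> 0"
      using m by (simp add: lookup_pd in_keys_iff del: of_nat_Suc)
    with pd0[OF \<open>i < d\<close>] show False
      by simp
  qed
  \<comment> \<open>Being constant, \<open>p\<close> itself meets the smaller degree bound, so the
    induction hypothesis applies to it as well.\<close>
  show ?case
  proof (rule Suc.IH)
    show "vanishes d x (Suc n) p"
      using Suc.prems(2) by (rule vanishes_SucD)
    show "(\<Sum>i<d. Poly_Mapping.lookup m i) \<le> n" if "m \<in> Poly_Mapping.keys p" for m
      using const[OF that] by simp
  qed (use Suc.prems(1) in auto)
qed

lemma eq_0_if_vanishes:
  assumes "in_vars d p" "\<And>n. vanishes d x n p"
  shows "p = 0"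
proof (rule eq_0_if_vanishes_degree[OF assms])
  fix m assume "m \<in> Poly_Mapping.keys p"
  then show "(\<Sum>i<d. Poly_Mapping.lookup m i) \<le>
      Max ((\<lambda>m. \<Sum>i<d. Poly_Mapping.lookup m i) ` Poly_Mapping.keys p)"
    by (intro Max_ge) auto
qed

section \<open>Injectivity of surjective Fischer operators\<close>

text \<open>Gaussian elimination: a nonzero entry of equation \<open>w\<close> serves as pivot to
  remove one unknown and one equation.\<close>

lemma homogeneous_system_nontrivial_solution:
  fixes a :: "'w \<Rightarrow> 'j \<Rightarrow> real"
  assumes "finite S" "finite J" "card S < card J"
  shows "\<exists>c. (\<exists>j\<in>J. c j \<noteq> 0) \<and> (\<forall>w\<in>S. (\<Sum>j\<in>J. c j * a w j) = 0)"
  using assms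
proof (induction S arbitrary: a J rule: finite_induct)
  case empty
  then have "J \<noteq> {}"
    by auto
  then show ?case
    by (intro exI[of _ "\<lambda>_. 1"]) auto
next
  case (insert w S)
  show ?case
  proof (cases "\<forall>j\<in>J. a w j = 0")
    case True
    with insert.IH[of J a] insert.prems insert.hyps show ?thesis
      by auto
  next
    case False
    then obtain p where p: "p \<in> J" "a w p \<noteq> 0"
      by blast
    define J' where "J' = J - {p}"
    have J': "finite J'" "p \<notin> J'" "J = insert p J'" "card S < card J'"
      using p insert.prems insert.hyps by (auto simp: J'_def)
    obtain c where c: "\<exists>j\<in>J'. c j \<noteq> 0"
      "\<And>v. v \<in> S \<Longrightarrow> (\<Sum>j\<in>J'. c j * (a v j - a v p * a w j / a w p)) = 0"
      using insert.IH[OF J'(1,4), of "\<lambda>v j. a v j - a v p * a w j / a w p"] by blast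
    \<comment> \<open>The value at the pivot \<open>p\<close> is the one that solves equation
      \<open>w\<close> for that unknown.\<close>
    define c' where "c' = c(p := - (\<Sum>j\<in>J'. c j * a w j) / a w p)"
    have c': "(\<Sum>j\<in>J. c' j * a v j) = (\<Sum>j\<in>J'. c j * (a v j - a v p * a w j / a w p))" for v
    proof -
      have "(\<Sum>j\<in>J. c' j * a v j) = c' p * a v p + (\<Sum>j\<in>J'. c' j * a v j)"
        using J' by simp
      also have "(\<Sum>j\<in>J'. c' j * a v j) = (\<Sum>j\<in>J'. c j * a v j)"
        using J' by (intro sum.cong) (auto simp: c'_def)
      also have "c' p * a v p = - (\<Sum>j\<in>J'. c j * (a v p * a w j / a w p))"
        by (simp add: c'_def sum_distrib_left sum_divide_distrib mult_ac)
      finally show ?thesis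
        by (simp add: right_diff_distrib sum_subtractf)
    qed
    show ?thesis
    proof (intro exI[of _ c'] conjI ballI)
      show "\<exists>j\<in>J. c' j \<noteq> 0"
        using c(1) J' by (auto simp: c'_def)
      \<comment> \<open>For \<open>v = w\<close> the reduced coefficients are all 0; for
        \<open>v\<close> in \<open>S\<close> the induction hypothesis gives the equation.\<close>
      fix v assume "v \<in> insert w S"
      then show "(\<Sum>j\<in>J. c' j * a v j) = 0"
        using c(2) p(2) by (auto simp: c')
    qed
  qed
qed

text \<open>The chain \<open>v\<close> below consists of iterated preimages of a kernel element; applying the
  operator shifts the coefficients of a linear combination down by one.\<close>

lemma chain_independent_mod_vanishes:
  assumes "meval g x = 0" "meval h x = 0"
    and "fischer d (g * h) (v 0) = 0" "\<And>j. fischer d (g * h) (v (Suc j)) = v j"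
    and "\<not> vanishes d x n (v 0)"
    and "vanishes d x n (\<Sum>j<N. Poly_Mapping.single 0 (c j) * v j)"
  shows "\<forall>j<N. c j = 0"
  using assms(6)
proof (induction N arbitrary: c)
  case (Suc N)
  let ?C = "\<lambda>j. Poly_Mapping.single 0 (c j) :: mpoly"
  have "fischer d (g * h) (\<Sum>j<Suc N. ?C j * v j) = (\<Sum>j<N. ?C (Suc j) * v j)"
    unfolding sum.lessThan_Suc_shift
    by (simp add: fischer_add fischer_sum fischer_scale assms(3,4))
  \<comment> \<open>The operator preserves the order of vanishing and kills \<open>v 0\<close>,
    which leaves a shorter combination for the induction hypothesis.\<close>
  then have "vanishes d x n (\<Sum>j<N. ?C (Suc j) * v j)"
    using vanishes_fischer[OF assms(1,2) Suc.prems] by simp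
  then have tail: "\<forall>j<N. c (Suc j) = 0"
    by (rule Suc.IH)
  have "c 0 = 0"
  proof (rule ccontr)
    assume "c 0 \<noteq> 0"
    have "vanishes d x n (?C 0 * v 0)"
      using Suc.prems tail unfolding sum.lessThan_Suc_shift by simp
    then have "vanishes d x n (Poly_Mapping.single 0 (1 / c 0) * (?C 0 * v 0))"
      by (rule vanishes_mult)
    also have "Poly_Mapping.single 0 (1 / c 0) * (?C 0 * v 0) = v 0"
      using \<open>c 0 \<noteq> 0\<close> by (simp add: mult_single flip: mult.assoc)
    finally show False
      using assms(5) by simp
  qed
  with tail show ?case
    by (auto simp: less_Suc_eq_0_disj)
qed simp

text \<open>If a kernel element did not vanish to order \<open>n\<close>, its iterated preimages
  would be infinitely many polynomials independent modulo vanishing to order \<open>n\<close>, a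
  condition given by finitely many linear equations.\<close>

lemma fischer_injective_if_surjective:
  assumes roots: "meval g x = 0" "meval h x = 0"
    and surj: "\<And>f. in_vars d f \<Longrightarrow> \<exists>q. in_vars d q \<and> fischer d (g * h) q = f"
    and ker: "in_vars d p" "fischer d (g * h) p = 0"
  shows "p = 0"
proof (rule eq_0_if_vanishes[OF ker(1)])
  fix n
  \<comment> \<open>The choice is meaningful only when the previous polynomial lies in the
    \<open>d\<close> variables, so membership is carried along the chain.\<close>
  define v where "v = rec_nat p (\<lambda>_ f. SOME q. in_vars d q \<and> fischer d (g * h) q = f)"
  have v: "in_vars d (v (Suc j)) \<and> fischer d (g * h) (v (Suc j)) = v j" if "in_vars d (v j)" for j
    using someI_ex[OF surj[OF that]] by (simp add: v_def)
  have "in_vars d (v j)" for j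
    by (induction j) (use ker(1) v in \<open>auto simp: v_def\<close>)
  with v have chain: "fischer d (g * h) (v (Suc j)) = v j" for j
    by blast
  define S where "S = {w. set w \<subseteq> {..<d} \<and> length w \<le> n}"
  have "finite S"
    unfolding S_def by (rule finite_lists_length_le) simp
  \<comment> \<open>One more chain element than conditions forces a nontrivial combination meeting
    them all.\<close>
  obtain c where c: "\<exists>j<Suc (card S). c j \<noteq> 0"
    "\<And>w. w \<in> S \<Longrightarrow> (\<Sum>j<Suc (card S). c j * meval (fold pd w (v j)) x) = 0"
    using homogeneous_system_nontrivial_solution[OF \<open>finite S\<close>, of "{..<Suc (card S)}"
        "\<lambda>w j. meval (fold pd w (v j)) x"] by (auto simp del: sum.lessThan_Suc)
  have "vanishes d x n (\<Sum>j<Suc (card S). Poly_Mapping.single 0 (c j) * v j)"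
    unfolding vanishes_def meval_fold_pd_lincomb using c(2) by (simp add: S_def del: sum.lessThan_Suc)
  \<comment> \<open>By independence of the chain, such a combination is possible only if
    \<open>v 0\<close>, which is \<open>p\<close>, vanishes to order \<open>n\<close>.\<close>
  with chain_independent_mod_vanishes[OF roots, of d v n c "Suc (card S)"] chain ker(2) c(1)
  show "vanishes d x n p"
    by (auto simp: v_def)
qed

section \<open>Non-surjectivity for at least three factors\<close>

theorem theorem2:
  fixes d k :: nat and \<phi> :: "nat \<Rightarrow> mpoly" and \<psi> :: mpoly
    and i j :: nat and x0 :: "nat \<Rightarrow> real"
  assumes "d \<ge> 1"
    and "k \<ge> 3"
    and "\<And>l. l < k \<Longrightarrow> in_vars d (\<phi> l) \<and> nonconstant (\<phi> l)"
    and "\<psi> = (\<Prod>l<k. \<phi> l)"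
    and "i < k" and "j < k" and "i \<noteq> j"
    and "meval (\<phi> i) x0 = 0" and "meval (\<phi> j) x0 = 0"
  shows "\<not> (\<forall>f. in_vars d f \<longrightarrow> (\<exists>q. in_vars d q \<and> fischer d \<psi> q = f))"
proof
  assume surj: "\<forall>f. in_vars d f \<longrightarrow> (\<exists>q. in_vars d q \<and> fischer d \<psi> q = f)"
  define R where "R = {..<k} - {i} - {j}"
  define \<theta> where "\<theta> = \<phi> i * \<phi> j"
  define \<chi> where "\<chi> = (\<Prod>l\<in>R. \<phi> l)"
  have "\<psi> = \<theta> * \<chi>"
    unfolding assms(4) \<theta>_def \<chi>_def R_def
    using assms(5-7) by (simp add: prod.remove[of _ i] prod.remove[of _ j] mult.assoc)
  then have split: "fischer d \<psi> q = fischer d \<theta> (\<chi> * q)" for q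
    by (simp add: fischer_def mult.assoc)
  have "in_vars d \<chi>"
    unfolding \<chi>_def by (rule in_vars_prod) (use assms(3) in \<open>auto simp: R_def\<close>)
  \<comment> \<open>Multiplying a preimage under the operator of \<open>\<psi>\<close> by
    \<open>\<chi>\<close> gives one under that of \<open>\<theta>\<close>.\<close>
  then have surj\<theta>: "\<exists>q. in_vars d q \<and> fischer d \<theta> q = f" if "in_vars d f" for f
    using surj that in_vars_mult unfolding split by blast
  have "in_vars d \<theta>"
    unfolding \<theta>_def by (intro in_vars_mult) (use assms(3,5,6) in auto)
  then have "in_vars d (fischer d \<theta> 1)"
    by (simp add: fischer_def in_vars_laplacian)
  then obtain q where q: "in_vars d q" "fischer d \<theta> (\<chi> * q) = fischer d \<theta> 1"
    using surj unfolding split by blast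
  have "\<chi> * q - 1 = 0"
  proof (rule fischer_injective_if_surjective[OF assms(8,9)])
    show "in_vars d (\<chi> * q - 1)"
      by (intro in_vars_diff in_vars_mult in_vars_1 q(1)) fact
    show "fischer d (\<phi> i * \<phi> j) (\<chi> * q - 1) = 0"
      using q(2) by (simp add: \<theta>_def fischer_minus)
  qed (use surj\<theta> in \<open>simp add: \<theta>_def\<close>)
  \<comment> \<open>At least three factors leave one besides \<open>\<phi> i\<close> and
    \<open>\<phi> j\<close>; it divides \<open>\<chi>\<close> and hence 1.\<close>
  have "card R = k - 2"
    using assms(5-7) by (simp add: R_def)
  then have "R \<noteq> {}"
    using assms(2) by auto
  then obtain l where l: "l \<in> R"
    by blast
  then have "\<chi> = \<phi> l * (\<Prod>l\<in>R - {l}. \<phi> l)"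
    unfolding \<chi>_def by (simp add: prod.remove R_def)
  with \<open>\<chi> * q - 1 = 0\<close> have "\<phi> l * ((\<Prod>l\<in>R - {l}. \<phi> l) * q) = 1"
    by (simp add: mult.assoc)
  from unit_not_nonconstant[OF this] show False
    using assms(3) l by (simp add: R_def)
qed

end
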